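(* Let $F=f+h$ satisfy the assumptions (i) and (ii) listed in the context, let $\alpha\in[0,1]$, let $x^0\in\mathbb{R}^n$ satisfy $a^Tx^0=0$, and assume $R_\alpha<\infty$. Assume in addition that $F$ is $\sigma_\alpha$-strongly convex with respect to $\|\cdot\|_\alpha$ (with $\sigma_\alpha>0$). Then the sequence $(x^k)_{k\ge0}$ generated by the random coordinate descent algorithm (RCD) described in the context, with pairs $(i_k,j_k)$ drawn independently from the uniform distribution $p_{ij}=\frac{2}{N(N-1)}$ on unordered pairs of distinct blocks, satisfies $$\phi^k-F^*\le\left(1-\frac{2(1-\gamma)}{N^2}\right)^k\left(F(x^0)-F^*\right)\qquad\text{for all }k\ge0,$$ where $$\gamma=\begin{cases}1-\dfrac{\sigma_\alpha}{8L^{1-\alpha}}, & \text{if }\sigma_\alpha\le 4L^{1-\alpha},\\[2mm] \dfrac{2L^{1-\alpha}}{\sigma_\alpha}, & \text{otherwise.}\end{cases}$$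
   Context: Problem: minimize $F(x):=f(x)+h(x)$ over $x\in\mathbb{R}^n$ subject to $a^Tx=0$, where $a\in\mathbb{R}^n$, $f:\mathbb{R}^n\to\mathbb{R}$ is smooth and convex, and $h:\mathbb{R}^n\to\mathbb{R}$ is closed and convex. $F^*$ is the optimal value and $X^*$ the set of optimal solutions of this problem. Blocks: $n=\sum_{i=1}^N n_i$ with $N\ge 2$, $I_n=[U_1\ \dots\ U_N]$ with $U_i\in\mathbb{R}^{n\times n_i}$; $x_i=U_i^Tx\in\mathbb{R}^{n_i}$ is the $i$th block of $x$, $a_i$ the $i$th block of $a$, $\nabla_i f(x)=U_i^T\nabla f(x)$; $\|\cdot\|$ on each $\mathbb{R}^{n_i}$ is the Euclidean norm. Assumptions: (i) $f$ is convex and there are constants $L_i>0$ with $\|\nabla_i f(x+U_ih_i)-\nabla_i f(x)\|\le L_i\|h_i\|$ for all $x\in\mathbb{R}^n$, $h_i\in\mathbb{R}^{n_i}$, $i=1,\dots,N$. (ii) $h$ is convex and coordinatewise separable (a sum of functions of the individual scalar coordinates). Notation: $L=\max_{1\le i\le N}L_i$; $\|x\|_\alpha=\left(\sum_{i=1}^N L_i^\alpha\|x_i\|^2\right)^{1/2}$; for a pair of blocks $s_{ij}=(s_i,s_j)\in\mathbb{R}^{n_i+n_j}$, $\|s_{ij}\|_\alpha^2=L_i^\alpha\|s_i\|^2+L_j^\alpha\|s_j\|^2$; $L_{ij}^\alpha=L_i^{1-\alpha}+L_j^{1-\alpha}$. $$R_\alpha=\max_x\left\{\max_{x^*\in X^*}\|x-x^*\|_\alpha:\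 F(x)\le F(x^0)\right\}.$$ Strong convexity: $F$ is $\sigma_\alpha$-strongly convex with respect to $\|\cdot\|_\alpha$ if $F(x)\ge F(y)+\langle F'(y),x-y\rangle+\frac{\sigma_\alpha}{2}\|x-y\|_\alpha^2$ for all $x,y\in\mathbb{R}^n$, where $F'(y)$ denotes a subgradient of $F$ at $y$. Algorithm (RCD): starting from a feasible $x^0$ ($a^Tx^0=0$), at each iteration $k\ge0$ choose a random pair $(i,j)=(i_k,j_k)$ with $i\ne j$ (pairs $(i,j)$ and $(j,i)$ are identified; the choices are i.i.d. over $k$), and set $x^{k+1}=x^k+U_id_i+U_jd_j$, where $(d_i,d_j)$ is the minimizer over $(s_i,s_j)\in\mathbb{R}^{n_i}\times\mathbb{R}^{n_j}$ of $$f(x^k)+\langle\nabla_i f(x^k),s_i\rangle+\langle\nabla_j f(x^k),s_j\rangle+\frac{L_{ij}^\alpha}{2}\|s_{ij}\|_\alpha^2+h(x^k+U_is_i+U_js_j)$$ subject to $a_i^Ts_i+a_j^Ts_j=0$. $\phi^k=E[F(x^k)]$, the expectation being over the random choices $(i_0,j_0),\dots,(i_{k-1},j_{k-1})$. *)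

theory Defs
  imports "HOL-Probability.Probability"
begin

text \<open>
  The block structure of \<open>real ^ 'n\<close> is a map \<open>b :: 'n \<Rightarrow> 'b\<close> sending each coordinate to its block;
  there are \<open>CARD('b)\<close> blocks, and the space of block \<open>i\<close> has dimension \<open>card (b -` {i})\<close>.
  A block vector is identified with its zero extension to \<open>real ^ 'n\<close>: writing \<open>U i\<close> for the block
  columns of the identity matrix, \<open>blk b i x\<close> is \<open>U i (U i)\<^sup>T x\<close>.  This identification preserves
  norms and inner products.
\<close>

definition blk :: "('n::finite \<Rightarrow> 'b) \<Rightarrow> 'b \<Rightarrow> real ^ 'n \<Rightarrow> real ^ 'n" where
  "blk b i x = (\<chi> c. if b c = i then x $ c else 0)"

definition block_lipschitz_gradient ::
    "('n::finite \<Rightarrow> 'b) \<Rightarrow> ('b \<Rightarrow> real) \<Rightarrow> (real ^ 'n \<Rightarrow> real ^ 'n) \<Rightarrow> bool" where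
  "block_lipschitz_gradient b L g \<longleftrightarrow>
     (\<forall>i x s. norm (blk b i (g (x + blk b i s)) - blk b i (g x)) \<le> L i * norm (blk b i s))"

definition coordinatewise_separable :: "(real ^ 'n::finite \<Rightarrow> real) \<Rightarrow> bool" where
  "coordinatewise_separable h \<longleftrightarrow> (\<exists>hc :: 'n \<Rightarrow> real \<Rightarrow> real. \<forall>x. h x = (\<Sum>c\<in>UNIV. hc c (x $ c)))"

definition wnorm :: "('n::finite \<Rightarrow> 'b::finite) \<Rightarrow> ('b \<Rightarrow> real) \<Rightarrow> real \<Rightarrow> real ^ 'n \<Rightarrow> real" where
  "wnorm b L \<alpha> x = sqrt (\<Sum>i\<in>UNIV. L i powr \<alpha> * (norm (blk b i x))\<^sup>2)"

definition subgradient :: "('a::real_inner \<Rightarrow> real) \<Rightarrow> 'a \<Rightarrow> 'a \<Rightarrow> bool" where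
  "subgradient F y g \<longleftrightarrow> (\<forall>z. F z \<ge> F y + g \<bullet> (z - y))"

definition strongly_convex_wrt :: "('a::real_inner \<Rightarrow> real) \<Rightarrow> real \<Rightarrow> ('a \<Rightarrow> real) \<Rightarrow> bool" where
  "strongly_convex_wrt nrm \<sigma> F \<longleftrightarrow>
     (\<forall>y. \<exists>g. subgradient F y g \<and> (\<forall>x. F x \<ge> F y + g \<bullet> (x - y) + \<sigma> / 2 * (nrm (x - y))\<^sup>2))"

definition optval :: "'a::real_inner \<Rightarrow> ('a \<Rightarrow> real) \<Rightarrow> real" where
  "optval a F = (INF x\<in>{x. a \<bullet> x = 0}. F x)"

definition optset :: "'a::real_inner \<Rightarrow> ('a \<Rightarrow> real) \<Rightarrow> 'a set" where
  "optset a F = {x. is_arg_min F (\<lambda>y. a \<bullet> y = 0) x}"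

definition level_radius :: "('a::real_inner \<Rightarrow> real) \<Rightarrow> 'a \<Rightarrow> ('a \<Rightarrow> real) \<Rightarrow> 'a \<Rightarrow> ereal" where
  "level_radius nrm a F x0 = (SUP x\<in>{x. F x \<le> F x0}. SUP xs\<in>optset a F. ereal (nrm (x - xs)))"

text \<open>
  An unordered pair of distinct blocks is a two-element set \<open>e = {i, j}\<close>, and \<open>(s\<^sub>i, s\<^sub>j)\<close> is encoded
  as the vector \<open>s = U i s\<^sub>i + U j s\<^sub>j\<close>, that is, as a vector vanishing outside the two blocks.
\<close>

definition pair_directions :: "('n::finite \<Rightarrow> 'b) \<Rightarrow> real ^ 'n \<Rightarrow> 'b set \<Rightarrow> (real ^ 'n) set" where
  "pair_directions b a e =
     {s. (\<forall>c. b c \<notin> e \<longrightarrow> s $ c = 0) \<and> (\<Sum>i\<in>e. blk b i a \<bullet> blk b i s) = 0}"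

definition pair_model ::
    "('n::finite \<Rightarrow> 'b) \<Rightarrow> ('b \<Rightarrow> real) \<Rightarrow> real \<Rightarrow> (real ^ 'n \<Rightarrow> real) \<Rightarrow> (real ^ 'n \<Rightarrow> real ^ 'n) \<Rightarrow>
     (real ^ 'n \<Rightarrow> real) \<Rightarrow> 'b set \<Rightarrow> real ^ 'n \<Rightarrow> real ^ 'n \<Rightarrow> real" where
  "pair_model b L \<alpha> f g h e x s =
     f x + (\<Sum>i\<in>e. blk b i (g x) \<bullet> blk b i s)
     + (\<Sum>i\<in>e. L i powr (1 - \<alpha>)) / 2 * (\<Sum>i\<in>e. L i powr \<alpha> * (norm (blk b i s))\<^sup>2)
     + h (x + s)"

text \<open>For positive \<open>L\<close> and convex \<open>h\<close> the model is strongly convex on the directions of the pair,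
  so the minimizer selected by \<^const>\<open>arg_min_on\<close> exists and is unique.\<close>

definition rcd_step ::
    "('n::finite \<Rightarrow> 'b) \<Rightarrow> ('b \<Rightarrow> real) \<Rightarrow> real \<Rightarrow> (real ^ 'n \<Rightarrow> real) \<Rightarrow> (real ^ 'n \<Rightarrow> real ^ 'n) \<Rightarrow>
     (real ^ 'n \<Rightarrow> real) \<Rightarrow> real ^ 'n \<Rightarrow> 'b set \<Rightarrow> real ^ 'n \<Rightarrow> real ^ 'n" where
  "rcd_step b L \<alpha> f g h a e x =
     x + arg_min_on (pair_model b L \<alpha> f g h e x) (pair_directions b a e)"

primrec rcd_iterate ::
    "('n::finite \<Rightarrow> 'b) \<Rightarrow> ('b \<Rightarrow> real) \<Rightarrow> real \<Rightarrow> (real ^ 'n \<Rightarrow> real) \<Rightarrow> (real ^ 'n \<Rightarrow> real ^ 'n) \<Rightarrow>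
     (real ^ 'n \<Rightarrow> real) \<Rightarrow> real ^ 'n \<Rightarrow> real ^ 'n \<Rightarrow> (nat \<Rightarrow> 'b set) \<Rightarrow> nat \<Rightarrow> real ^ 'n" where
  "rcd_iterate b L \<alpha> f g h a x0 p 0 = x0"
| "rcd_iterate b L \<alpha> f g h a x0 p (Suc k) =
     rcd_step b L \<alpha> f g h a (p k) (rcd_iterate b L \<alpha> f g h a x0 p k)"

definition rcd_gamma :: "real \<Rightarrow> real \<Rightarrow> real \<Rightarrow> real" where
  "rcd_gamma Lmax \<alpha> \<sigma> =
     (if \<sigma> \<le> 4 * Lmax powr (1 - \<alpha>) then 1 - \<sigma> / (8 * Lmax powr (1 - \<alpha>))
      else 2 * Lmax powr (1 - \<alpha>) / \<sigma>)"

end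

theory Submission
  imports Defs
begin

text \<open>
  The multi-block descent inequality gives \<open>F (x + s) \<le> \<psi> e s\<close>, where \<open>\<psi> e\<close> is the model of the pair
  \<open>e\<close>, so \<open>F\<close> after a step is at most \<open>\<psi> e s\<close> for every pair direction \<open>s\<close>.  An arbitrary \<open>s\<close> with
  \<open>a \<bullet> s = 0\<close> splits into pair directions \<open>t e\<close> whose blocks are convex multiples of the blocks of \<open>s\<close>;
  convexity and separability then give
  \<open>(\<Sum>e. \<psi> e (t e) - F x) \<le> F (x + s) - F x + \<Lambda> \<parallel>s\<parallel>\<^sup>2\<close>, where \<open>\<Lambda>\<close> is \<open>Max (range L) powr (1 - \<alpha>)\<close> and
  the norm is the one weighted by \<open>L i powr \<alpha>\<close>.  For \<open>s = \<beta> (y - x)\<close> with \<open>\<beta> = \<sigma> / (2 \<Lambda> + \<sigma>)\<close> strong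
  convexity absorbs the last term, which bounds the sum by \<open>- \<beta> (F x - F y)\<close>.  Taking the infimum over
  feasible \<open>y\<close> and the mean over the pairs yields a contraction of the expected gap, and
  \<open>\<beta> \<ge> 1 - \<gamma>\<close>.
\<close>

section \<open>Block projections and the weighted norm\<close>

lemma blk_nth [simp]: "blk b i x $ c = (if b c = i then x $ c else 0)"
  by (simp add: blk_def)

lemma blk_scaleR [simp]: "blk b i (r *\<^sub>R x) = r *\<^sub>R blk b i x"
  by (simp add: vec_eq_iff)

lemma blk_0 [simp]: "blk b i 0 = 0"
  by (simp add: vec_eq_iff)

lemma blk_diff: "blk b i (x - y) = blk b i x - blk b i y"
  by (simp add: vec_eq_iff)

lemma blk_blk [simp]: "blk b i (blk b i x) = blk b i x"
  by (simp add: vec_eq_iff)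

lemma inner_blk: "blk b i x \<bullet> blk b i y = x \<bullet> blk b i y"
  unfolding inner_vec_def by (intro sum.cong) auto

lemma sum_blk:
  fixes b :: "'n::finite \<Rightarrow> 'b::finite" and x :: "real ^ 'n"
  assumes "\<And>c. b c \<notin> e \<Longrightarrow> x $ c = 0"
  shows "(\<Sum>i\<in>e. blk b i x) = x"
proof -
  have "(\<Sum>i\<in>e. if b c = i then x $ c else 0) = x $ c" for c
    using assms[of c] by (simp add: sum.delta)
  then show ?thesis by (simp add: vec_eq_iff)
qed

lemma sum_inner_blk:
  fixes b :: "'n::finite \<Rightarrow> 'b::finite" and x y :: "real ^ 'n"
  assumes "\<And>c. b c \<notin> e \<Longrightarrow> y $ c = 0"
  shows "(\<Sum>i\<in>e. blk b i x \<bullet> blk b i y) = x \<bullet> y"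
  by (simp add: inner_blk sum_blk[OF assms] flip: inner_sum_right)

lemma wnorm_power2:
  assumes "\<And>i. L i > 0"
  shows "(wnorm b L \<alpha> x)\<^sup>2 = (\<Sum>i\<in>UNIV. L i powr \<alpha> * (norm (blk b i x))\<^sup>2)"
  unfolding wnorm_def by (intro real_sqrt_pow2 sum_nonneg) auto

lemma wnorm_scaleR_power2:
  assumes "\<And>i. L i > 0"
  shows "(wnorm b L \<alpha> (r *\<^sub>R x))\<^sup>2 = r\<^sup>2 * (wnorm b L \<alpha> x)\<^sup>2"
  by (simp add: wnorm_power2[OF assms] power_mult_distrib sum_distrib_left mult_ac)

text \<open>Strong convexity is measured in the weighted norm, compactness in the Euclidean one; the
  smallest weight compares the two.\<close>

lemma wnorm_power2_ge:
  fixes b :: "'n::finite \<Rightarrow> 'b::finite"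
  assumes "\<And>i. L i > 0"
  obtains m where "m > 0" "\<And>x. (wnorm b L \<alpha> x)\<^sup>2 \<ge> m * (norm x)\<^sup>2"
proof
  let ?m = "Min (range (\<lambda>i. L i powr \<alpha>))"
  show "?m > 0" using assms by (subst Min_gr_iff) (auto simp: less_le)
  fix x :: "real ^ 'n"
  have "?m * (norm x)\<^sup>2 = (\<Sum>i\<in>UNIV. ?m * (norm (blk b i x))\<^sup>2)"
    using sum_inner_blk[of b UNIV x x] by (simp add: power2_norm_eq_inner flip: sum_distrib_left)
  also have "\<dots> \<le> (wnorm b L \<alpha> x)\<^sup>2"
    unfolding wnorm_power2[OF assms] by (intro sum_mono mult_right_mono) auto
  finally show "(wnorm b L \<alpha> x)\<^sup>2 \<ge> ?m * (norm x)\<^sup>2" .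
qed

section \<open>Descent inequalities for the smooth part\<close>

lemma gderiv_along_line:
  assumes "\<And>x. GDERIV f x :> g x"
  shows "((\<lambda>t. f (x + t *\<^sub>R s)) has_real_derivative g (x + t *\<^sub>R s) \<bullet> s) (at t)"
proof -
  have "((\<lambda>t. x + t *\<^sub>R s) has_derivative (\<lambda>t. t *\<^sub>R s)) (at t)"
    by (auto intro!: derivative_eq_intros)
  from has_derivative_compose[OF this assms[unfolded gderiv_def]]
  show ?thesis by (simp add: has_field_derivative_def inner_commute mult_commute_abs)
qed

text \<open>On the line through \<open>x\<close> in direction \<open>s\<close> this is the tangent
  inequality of a convex function of one variable, between the parameters 0 and 1.\<close>

lemma convex_above_gradient:
  assumes "convex_on UNIV f" and "\<And>x. GDERIV f x :> g x"
  shows "f (x + s) \<ge> f x + g x \<bullet> s"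
proof -
  have conv: "convex_on UNIV (\<lambda>t::real. f (x + t *\<^sub>R s))"
  proof (rule convex_onI)
    fix t u v :: real assume t: "0 < t" "t < 1"
    have "x + ((1 - t) *\<^sub>R u + t *\<^sub>R v) *\<^sub>R s
        = (1 - t) *\<^sub>R (x + u *\<^sub>R s) + t *\<^sub>R (x + v *\<^sub>R s)"
      by (simp add: algebra_simps)
    then show "f (x + ((1 - t) *\<^sub>R u + t *\<^sub>R v) *\<^sub>R s)
        \<le> (1 - t) * f (x + u *\<^sub>R s) + t * f (x + v *\<^sub>R s)"
      using convex_onD[OF assms(1), of t] t by simp
  qed simp
  show ?thesis
    using convex_on_imp_above_tangent[OF conv, where c = 0 and x = 1 and f' = "g x \<bullet> s"] gderiv_along_line[OF assms(2), of x s 0]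
    by simp
qed

lemma block_descent:
  assumes grad: "\<And>x. GDERIV f x :> g x" and lip: "block_lipschitz_gradient b L g"
  shows "f (x + blk b i s) \<le> f x + blk b i (g x) \<bullet> blk b i s + L i / 2 * (norm (blk b i s))\<^sup>2"
proof -
  let ?v = "blk b i s"
  \<comment> \<open>The gap between \<open>f\<close> along the block and the linear and quadratic
    terms of its upper bound. Its derivative is a gradient difference minus the Lipschitz bound,
    hence nonpositive on the unit interval.\<close>
  let ?\<psi> = "\<lambda>t. f (x + t *\<^sub>R ?v) - t * (g x \<bullet> ?v) - L i / 2 * t\<^sup>2 * (norm ?v)\<^sup>2"
  have "?\<psi> 1 \<le> ?\<psi> 0"
  proof (rule DERIV_nonpos_imp_nonincreasing[where f = ?\<psi>])
    fix t :: real assume t: "0 \<le> t" "t \<le> 1"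
    have "g (x + t *\<^sub>R ?v) \<bullet> ?v - g x \<bullet> ?v = blk b i (g (x + t *\<^sub>R ?v) - g x) \<bullet> ?v"
      by (metis inner_blk blk_blk inner_diff_left)
    also have "\<dots> \<le> norm (blk b i (g (x + t *\<^sub>R ?v) - g x)) * norm ?v"
      by (rule norm_cauchy_schwarz)
    also have "\<dots> \<le> (L i * norm (blk b i (t *\<^sub>R s))) * norm ?v"
      using lip[unfolded block_lipschitz_gradient_def, rule_format, of i x "t *\<^sub>R s"]
      by (intro mult_right_mono) (auto simp: blk_diff)
    also have "\<dots> = L i * t * (norm ?v)\<^sup>2"
      using t by (simp add: power2_eq_square)
    finally have "g (x + t *\<^sub>R ?v) \<bullet> ?v - g x \<bullet> ?v - L i * t * (norm ?v)\<^sup>2 \<le> 0" by simp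
    moreover have "(?\<psi> has_real_derivative
        g (x + t *\<^sub>R ?v) \<bullet> ?v - g x \<bullet> ?v - L i * t * (norm ?v)\<^sup>2) (at t)"
      by (auto intro!: derivative_eq_intros gderiv_along_line[OF grad])
    ultimately show "\<exists>y. (?\<psi> has_real_derivative y) (at t) \<and> y \<le> 0" by blast
  qed simp
  then show ?thesis by (simp add: inner_blk)
qed

text \<open>Jensen's inequality for \<open>x + s = (\<Sum>i\<in>e. \<lambda> i *\<^sub>R (x + blk b i s /\<^sub>R \<lambda> i))\<close> with weights \<open>\<lambda> i\<close>
  proportional to \<open>L i powr (1 - \<alpha>)\<close>, so that all \<open>L i / \<lambda> i\<close> are the same multiple of \<open>L i powr \<alpha>\<close>.\<close>

lemma multi_block_descent:
  fixes b :: "'n::finite \<Rightarrow> 'b::finite"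
  assumes conv: "convex_on UNIV f" and grad: "\<And>x. GDERIV f x :> g x"
    and lip: "block_lipschitz_gradient b L g" and L_pos: "\<And>i. L i > 0"
    and s: "\<And>c. b c \<notin> e \<Longrightarrow> s $ c = 0"
  shows "f (x + s) \<le> f x + (\<Sum>i\<in>e. blk b i (g x) \<bullet> blk b i s)
    + (\<Sum>i\<in>e. L i powr (1 - \<alpha>)) / 2 * (\<Sum>i\<in>e. L i powr \<alpha> * (norm (blk b i s))\<^sup>2)"
proof (cases "e = {}")
  case True
  then have "s = 0" using s by (simp add: vec_eq_iff)
  then show ?thesis using True by simp
next
  case False
  define \<Lambda> where "\<Lambda> = (\<Sum>i\<in>e. L i powr (1 - \<alpha>))"
  define l where "l i = L i powr (1 - \<alpha>) / \<Lambda>" for i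
  have "\<Lambda> > 0" unfolding \<Lambda>_def using False L_pos by (intro sum_pos) (auto simp: less_le)
  then have l_pos: "l i > 0" for i using L_pos[of i] by (simp add: l_def)
  have l_sum: "sum l e = 1"
    using \<open>\<Lambda> > 0\<close> by (simp add: l_def \<Lambda>_def flip: sum_divide_distrib)
  have L_eq: "L i / l i = \<Lambda> * L i powr \<alpha>" for i
  proof -
    have "L i = L i powr (1 - \<alpha>) * L i powr \<alpha>"
      using L_pos[of i] by (simp flip: powr_add)
    then show ?thesis using \<open>\<Lambda> > 0\<close> L_pos[of i] by (simp add: l_def field_simps)
  qed
  let ?y = "\<lambda>i. x + blk b i (s /\<^sub>R l i)"
  have "(\<Sum>i\<in>e. l i *\<^sub>R ?y i) = (\<Sum>i\<in>e. l i *\<^sub>R x) + (\<Sum>i\<in>e. blk b i s)"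
    using l_pos by (simp add: scaleR_add_right sum.distrib less_imp_neq[symmetric])
  also have "\<dots> = x + s" by (simp add: l_sum sum_blk[OF s] flip: scaleR_left.sum)
  finally have "f (x + s) = f (\<Sum>i\<in>e. l i *\<^sub>R ?y i)" by simp
  also have "\<dots> \<le> (\<Sum>i\<in>e. l i * f (?y i))"
    using False l_sum l_pos by (intro convex_on_sum[OF _ _ conv]) (auto intro: less_imp_le)
  also have "\<dots> \<le> (\<Sum>i\<in>e. l i * f x + blk b i (g x) \<bullet> blk b i s
      + \<Lambda> / 2 * (L i powr \<alpha> * (norm (blk b i s))\<^sup>2))"
  proof (rule sum_mono)
    fix i
    have "l i * f (?y i) \<le> l i * (f x + blk b i (g x) \<bullet> blk b i (s /\<^sub>R l i)
        + L i / 2 * (norm (blk b i (s /\<^sub>R l i)))\<^sup>2)"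
      using l_pos[of i] block_descent[OF grad lip, of x i "s /\<^sub>R l i"]
      by (intro mult_left_mono) simp_all
    also have "\<dots> = l i * f x + blk b i (g x) \<bullet> blk b i s + L i / l i / 2 * (norm (blk b i s))\<^sup>2"
      using l_pos[of i] by (simp add: power_mult_distrib field_simps power2_eq_square)
    finally show "l i * f (?y i) \<le> l i * f x + blk b i (g x) \<bullet> blk b i s
        + \<Lambda> / 2 * (L i powr \<alpha> * (norm (blk b i s))\<^sup>2)" by (simp add: L_eq)
  qed
  also have "\<dots> = f x + (\<Sum>i\<in>e. blk b i (g x) \<bullet> blk b i s)
      + \<Lambda> / 2 * (\<Sum>i\<in>e. L i powr \<alpha> * (norm (blk b i s))\<^sup>2)"
    by (simp add: sum.distrib sum_distrib_left l_sum flip: sum_distrib_right)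
  finally show ?thesis by (simp add: \<Lambda>_def)
qed

section \<open>Splitting a feasible direction over pairs of blocks\<close>

lemma sum_pairs_swap:
  fixes \<theta> :: "'b::finite set \<Rightarrow> 'b \<Rightarrow> real"
  shows "(\<Sum>e | card e = 2. \<Sum>i\<in>e. \<theta> e i * D i) = (\<Sum>i\<in>UNIV. (\<Sum>e | card e = 2 \<and> i \<in> e. \<theta> e i) * D i)"
  using sum.swap_restrict[of "{e::'b set. card e = 2}" UNIV "\<lambda>e i. \<theta> e i * D i" "\<lambda>e i. i \<in> e"]
  by (simp add: sum_distrib_right)

lemma sum_pairs_containing:
  fixes i :: "'b::finite"
  shows "(\<Sum>e | card e = 2 \<and> i \<in> e. \<phi> e) = (\<Sum>j\<in>UNIV - {i}. \<phi> {i, j})"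
proof (rule sum.reindex_bij_betw[symmetric])
  show "bij_betw (\<lambda>j. {i, j}) (UNIV - {i}) {e. card e = 2 \<and> i \<in> e}"
    by (auto simp: bij_betw_def inj_on_def doubleton_eq_iff card_2_iff image_iff)
qed

text \<open>The weights split \<open>s\<close> into pair directions \<open>t e\<close> whose block \<open>i\<close> is \<open>\<theta> e i\<close> times that of \<open>s\<close>,
  where \<open>q i\<close> is the contribution of block \<open>i\<close> to the constraint.  They are the normalized product
  coupling of the positive part with the negative part of \<open>q\<close>.\<close>

lemma pair_weights_exist:
  fixes q :: "'b::finite \<Rightarrow> real"
  assumes "CARD('b) \<ge> 2" and q_sum: "sum q UNIV = 0"
  obtains \<theta> :: "'b set \<Rightarrow> 'b \<Rightarrow> real" where
    "\<And>e i. \<theta> e i \<ge> 0"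
    "\<And>i. (\<Sum>e | card e = 2 \<and> i \<in> e. \<theta> e i) = 1"
    "\<And>e. card e = 2 \<Longrightarrow> (\<Sum>i\<in>e. \<theta> e i * q i) = 0"
proof
  define T where "T = (\<Sum>i\<in>UNIV. max (q i) 0)"
  have "T = (\<Sum>i\<in>UNIV. q i + max (- q i) 0)"
    unfolding T_def by (intro sum.cong) auto
  then have T_neg: "T = (\<Sum>i\<in>UNIV. max (- q i) 0)" by (simp add: sum.distrib q_sum)
  \<comment> \<open>The positive and negative parts of \<open>q\<close> have the same total
    \<open>T\<close>, so a nonzero entry of either sign makes division by \<open>T\<close>
    legitimate.\<close>
  have T_pos: "T > 0" if "q i \<noteq> 0" for i
  proof (cases "q i > 0")
    case True
    then show ?thesis unfolding T_def by (intro sum_pos2[of _ i]) auto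
  next
    case False
    then show ?thesis using that unfolding T_neg by (intro sum_pos2[of _ i]) auto
  qed
  \<comment> \<open>\<open>w i j\<close> is the share of block \<open>i\<close> handled by the pair
    \<open>{i, j}\<close>. A block with \<open>q i = 0\<close> contributes nothing to any pair
    constraint, so its share is spread evenly over its \<open>CARD('b) - 1\<close> partners.\<close>
  define w where "w i j =
    (if q i = 0 then 1 / (real CARD('b) - 1)
     else if q i > 0 then max (- q j) 0 / T else max (q j) 0 / T)" for i j
  define \<theta> where "\<theta> e i = (\<Sum>j\<in>e - {i}. w i j)" for e i
  have "T \<ge> 0" unfolding T_def by (intro sum_nonneg) auto
  then have w_nonneg: "w i j \<ge> 0" for i j using assms(1) by (auto simp: w_def)
  then show "\<theta> e i \<ge> 0" for e i unfolding \<theta>_def by (intro sum_nonneg) auto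
  have w_sum: "(\<Sum>j\<in>UNIV - {i}. w i j) = 1" for i
  proof -
    consider "q i = 0" | "q i > 0" | "q i < 0" by linarith
    then show ?thesis
    proof cases
      case 1
      then show ?thesis using assms(1) by (simp add: w_def card_Diff_singleton of_nat_diff)
    next
      case 2
      then have "(\<Sum>j\<in>UNIV - {i}. w i j) = (\<Sum>j\<in>UNIV - {i}. max (- q j) 0) / T"
        by (simp add: w_def sum_divide_distrib)
      also have "(\<Sum>j\<in>UNIV - {i}. max (- q j) 0) = T"
        using 2 unfolding T_neg by (intro sum.mono_neutral_left) auto
      finally show ?thesis using T_pos[of i] 2 by simp
    next
      case 3
      then have "(\<Sum>j\<in>UNIV - {i}. w i j) = (\<Sum>j\<in>UNIV - {i}. max (q j) 0) / T"
        by (simp add: w_def sum_divide_distrib)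
      also have "(\<Sum>j\<in>UNIV - {i}. max (q j) 0) = T"
        using 3 unfolding T_def by (intro sum.mono_neutral_left) auto
      finally show ?thesis using T_pos[of i] 3 by simp
    qed
  qed
  have \<theta>_pair: "\<theta> {i, j} i = w i j" if "j \<noteq> i" for i j
    using that by (simp add: \<theta>_def insert_Diff_if)
  have "(\<Sum>e | card e = 2 \<and> i \<in> e. \<theta> e i) = (\<Sum>j\<in>UNIV - {i}. w i j)" for i
    unfolding sum_pairs_containing by (intro sum.cong) (auto simp: \<theta>_pair)
  then show "(\<Sum>e | card e = 2 \<and> i \<in> e. \<theta> e i) = 1" for i by (simp add: w_sum)
  show "(\<Sum>i\<in>e. \<theta> e i * q i) = 0" if "card e = 2" for e
  proof -
    from that obtain i j where e: "e = {i, j}" "i \<noteq> j" by (auto simp: card_2_iff)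
    \<comment> \<open>For opposite signs the two products are \<open>q i * q j / T\<close> and its
      negative; for equal signs both shares vanish; a zero entry gives a nonzero partner the share
      0.\<close>
    have "w i j * q i + w j i * q j = 0" by (auto simp: w_def max_def)
    then show ?thesis
      using e \<theta>_pair[of j i] \<theta>_pair[of i j] by (simp add: insert_commute)
  qed
qed

section \<open>Consequences of separability and strong convexity\<close>

lemma separable_block_sum:
  fixes b :: "'n::finite \<Rightarrow> 'b::finite"
  assumes "coordinatewise_separable h" and t: "\<And>c. b c \<notin> e \<Longrightarrow> t $ c = 0"
  shows "h (x + t) - h x = (\<Sum>i\<in>e. h (x + blk b i t) - h x)"
proof -
  obtain hc where hc: "\<And>x. h x = (\<Sum>c\<in>UNIV. hc c (x $ c))"
    using assms(1) by (auto simp: coordinatewise_separable_def)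
  have "(\<Sum>i\<in>e. h (x + blk b i t) - h x)
      = (\<Sum>i\<in>e. \<Sum>c\<in>UNIV. if b c = i then hc c (x $ c + t $ c) - hc c (x $ c) else 0)"
    unfolding hc sum_subtractf[symmetric] by (intro sum.cong) auto
  \<comment> \<open>A coordinate lies in exactly one block, so it is counted once if that block is
    in \<open>e\<close>; otherwise its increment is zero.\<close>
  also have "\<dots> = (\<Sum>c\<in>UNIV. hc c (x $ c + t $ c) - hc c (x $ c))"
    using t by (subst sum.swap) (auto intro!: sum.cong)
  finally show ?thesis by (simp add: hc sum_subtractf)
qed

text \<open>The inequalities based at the intermediate point are evaluated at both endpoints and
  averaged: the subgradient terms cancel, and \<open>(1 - \<beta>) * \<beta>\<^sup>2 + \<beta> * (1
  - \<beta>)\<^sup>2 = \<beta> * (1 - \<beta>)\<close>.\<close>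

lemma strongly_convex_wrt_segment:
  assumes L_pos: "\<And>i. L i > 0" and F: "strongly_convex_wrt (wnorm b L \<alpha>) \<sigma> F"
    and \<beta>: "0 \<le> \<beta>" "\<beta> \<le> 1"
  shows "F (x + \<beta> *\<^sub>R s) \<le> (1 - \<beta>) * F x + \<beta> * F (x + s) - \<sigma> / 2 * \<beta> * (1 - \<beta>) * (wnorm b L \<alpha> s)\<^sup>2"
proof -
  let ?z = "x + \<beta> *\<^sub>R s" and ?W = "(wnorm b L \<alpha> s)\<^sup>2"
  obtain v where v: "\<And>y. F y \<ge> F ?z + v \<bullet> (y - ?z) + \<sigma> / 2 * (wnorm b L \<alpha> (y - ?z))\<^sup>2"
    using F by (auto simp: strongly_convex_wrt_def)
  have d: "x - ?z = (- \<beta>) *\<^sub>R s" "x + s - ?z = (1 - \<beta>) *\<^sub>R s" by (simp_all add: algebra_simps)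
  have "F ?z - \<beta> * (v \<bullet> s) + \<sigma> / 2 * (\<beta>\<^sup>2 * ?W) \<le> F x"
    "F ?z + (1 - \<beta>) * (v \<bullet> s) + \<sigma> / 2 * ((1 - \<beta>)\<^sup>2 * ?W) \<le> F (x + s)"
    using v[of x] v[of "x + s"] unfolding d wnorm_scaleR_power2[OF L_pos] by simp_all
  then have "(1 - \<beta>) * (F ?z - \<beta> * (v \<bullet> s) + \<sigma> / 2 * (\<beta>\<^sup>2 * ?W))
      + \<beta> * (F ?z + (1 - \<beta>) * (v \<bullet> s) + \<sigma> / 2 * ((1 - \<beta>)\<^sup>2 * ?W))
    \<le> (1 - \<beta>) * F x + \<beta> * F (x + s)"
    using \<beta> by (intro add_mono mult_left_mono) auto
  also have "(1 - \<beta>) * (F ?z - \<beta> * (v \<bullet> s) + \<sigma> / 2 * (\<beta>\<^sup>2 * ?W))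
      + \<beta> * (F ?z + (1 - \<beta>) * (v \<bullet> s) + \<sigma> / 2 * ((1 - \<beta>)\<^sup>2 * ?W))
    = F ?z + \<sigma> / 2 * \<beta> * (1 - \<beta>) * ?W"
    by (simp add: algebra_simps power2_eq_square add_divide_distrib diff_divide_distrib)
  finally show ?thesis by simp
qed

text \<open>Coercivity in the Euclidean norm, used to bound sublevel sets in
  \<open>model_minimizer_exists\<close> and \<open>F\<close> from below in
  \<open>F_bounded_below\<close>.\<close>

lemma strongly_convex_wrt_norm_bound:
  fixes b :: "'n::finite \<Rightarrow> 'b::finite"
  assumes L_pos: "\<And>i. L i > 0" and "\<sigma> > 0" and F: "strongly_convex_wrt (wnorm b L \<alpha>) \<sigma> F"
  obtains c and v :: "real ^ 'n" where "c > 0" "\<And>s. F (x + s) \<ge> F x - norm v * norm s + c * (norm s)\<^sup>2"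
proof -
  obtain m where m: "m > 0" "\<And>s. (wnorm b L \<alpha> s)\<^sup>2 \<ge> m * (norm s)\<^sup>2"
    by (rule wnorm_power2_ge[where b = b and L = L and \<alpha> = \<alpha>, OF L_pos]) blast
  obtain v where v: "\<And>y. F y \<ge> F x + v \<bullet> (y - x) + \<sigma> / 2 * (wnorm b L \<alpha> (y - x))\<^sup>2"
    using F by (auto simp: strongly_convex_wrt_def)
  show thesis
  proof (rule that[of "\<sigma> / 2 * m" v])
    show "\<sigma> / 2 * m > 0" using m \<open>\<sigma> > 0\<close> by simp
    fix s
    have "\<sigma> / 2 * (m * (norm s)\<^sup>2) \<le> \<sigma> / 2 * (wnorm b L \<alpha> s)\<^sup>2"
      using m \<open>\<sigma> > 0\<close> by (intro mult_left_mono) auto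
    moreover have "- (norm v * norm s) \<le> v \<bullet> s"
      using Cauchy_Schwarz_ineq2[of v s] by simp
    ultimately show "F (x + s) \<ge> F x - norm v * norm s + \<sigma> / 2 * m * (norm s)\<^sup>2"
      using v[of "x + s"] by simp
  qed
qed

section \<open>The pair model and a single step\<close>

locale composite_problem =
  fixes f h F :: "real ^ 'n::finite \<Rightarrow> real"
    and g :: "real ^ 'n \<Rightarrow> real ^ 'n"
    and a :: "real ^ 'n"
    and b :: "'n \<Rightarrow> 'b::finite"
    and L :: "'b \<Rightarrow> real"
    and \<alpha> \<sigma> :: real
  assumes two_blocks: "CARD('b) \<ge> 2"
    and f_convex: "convex_on UNIV f"
    and f_gradient: "\<And>x. GDERIV f x :> g x"
    and L_pos: "\<And>i. L i > 0"
    and f_lipschitz: "block_lipschitz_gradient b L g"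
    and h_convex: "convex_on UNIV h"
    and h_separable: "coordinatewise_separable h"
    and F_eq: "\<And>x. F x = f x + h x"
    and \<alpha>_le_1: "\<alpha> \<le> 1"
    and \<sigma>_pos: "\<sigma> > 0"
    and F_strongly_convex: "strongly_convex_wrt (wnorm b L \<alpha>) \<sigma> F"
begin

abbreviation model :: "'b set \<Rightarrow> real ^ 'n \<Rightarrow> real ^ 'n \<Rightarrow> real" where
  "model \<equiv> pair_model b L \<alpha> f g h"

abbreviation step :: "'b set \<Rightarrow> real ^ 'n \<Rightarrow> real ^ 'n" where
  "step \<equiv> rcd_step b L \<alpha> f g h a"

definition Lmax_pow :: real where
  "Lmax_pow = Max (range L) powr (1 - \<alpha>)"

lemma Lmax_pow_pos: "Lmax_pow > 0"
proof -
  have "Max (range L) > 0" using L_pos by (subst Max_gr_iff) auto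
  then show ?thesis by (simp add: Lmax_pow_def)
qed

lemma pow_le_Lmax_pow: "L i powr (1 - \<alpha>) \<le> Lmax_pow"
  unfolding Lmax_pow_def using L_pos[of i] \<alpha>_le_1 by (intro powr_mono2) auto

text \<open>The quadratic coefficient of the model is exactly the one in
  \<open>multi_block_descent\<close>.\<close>

lemma F_le_model:
  assumes "s \<in> pair_directions b a e"
  shows "F (x + s) \<le> model e x s"
  using multi_block_descent[OF f_convex f_gradient f_lipschitz L_pos, where e = e and s = s and x = x] assms
  by (auto simp: pair_directions_def pair_model_def F_eq)

lemma model_0: "model e x 0 = F x"
  by (simp add: pair_model_def F_eq)

lemma continuous_on_blk: "continuous_on S (\<lambda>s::real ^ 'n. blk b i s)"
proof -
  have "continuous_on S (\<lambda>s::real ^ 'n. if b c = i then s $ c else 0)" for c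
    by (cases "b c = i") (auto intro!: continuous_intros)
  then show ?thesis unfolding blk_def by (rule continuous_on_vec_lambda)
qed

lemma continuous_on_model: "continuous_on S (model e x)"
proof -
  have "continuous_on UNIV h" using h_convex by (intro convex_on_continuous) auto
  then have "continuous_on S (\<lambda>s. h (x + s))"
    by (rule continuous_on_compose2) (auto intro!: continuous_intros)
  then show ?thesis unfolding pair_model_def
    by (intro continuous_intros continuous_on_blk)
qed

lemma closed_pair_directions: "closed (pair_directions b a e)"
proof -
  have "pair_directions b a e =
      (\<Inter>c\<in>{c. b c \<notin> e}. {s. s $ c = 0}) \<inter> {s. (\<Sum>i\<in>e. blk b i a \<bullet> blk b i s) = 0}"
    by (auto simp: pair_directions_def)
  then show ?thesis
    by (auto intro!: closed_Int closed_INT closed_Collect_eq continuous_intros continuous_on_blk)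
qed

text \<open>The model dominates \<open>F\<close>, which grows quadratically, so the pair directions
  with model value at most \<open>F x\<close>, its value at 0, form a compact set.\<close>

lemma model_minimizer_exists:
  "\<exists>s\<in>pair_directions b a e. \<forall>t\<in>pair_directions b a e. model e x s \<le> model e x t"
proof -
  let ?D = "pair_directions b a e"
  let ?K = "?D \<inter> {s. model e x s \<le> F x}"
  obtain c and v :: "real ^ 'n" where c: "c > 0" and v: "\<And>s. F (x + s) \<ge> F x - norm v * norm s + c * (norm s)\<^sup>2"
    by (rule strongly_convex_wrt_norm_bound[OF L_pos \<sigma>_pos F_strongly_convex]) blast
  have "norm s \<le> norm v / c" if "s \<in> ?K" for s
  proof (cases "s = 0")
    case False
    have "F (x + s) \<le> F x" using that F_le_model[of s e x] by simp
    with v[of s] have "c * (norm s)\<^sup>2 \<le> norm v * norm s" by linarith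
    then have "(c * norm s) * norm s \<le> norm v * norm s" by (simp add: power2_eq_square)
    then have "c * norm s \<le> norm v" using False by (subst (asm) mult_le_cancel_right_pos) simp_all
    then show ?thesis using c by (simp add: field_simps)
  qed (use c in simp)
  then have "bounded ?K" unfolding bounded_iff by blast
  moreover have "closed ?K"
    by (intro closed_Int closed_pair_directions closed_Collect_le continuous_on_model continuous_on_const)
  ultimately have "compact ?K" by (simp add: compact_eq_bounded_closed)
  moreover have "0 \<in> ?D" by (simp add: pair_directions_def)
  then have "0 \<in> ?K" by (simp add: model_0)
  ultimately obtain s where s: "s \<in> ?K" "\<And>t. t \<in> ?K \<Longrightarrow> model e x s \<le> model e x t"
    using continuous_attains_inf[of ?K "model e x"] continuous_on_model by blast
  \<comment> \<open>Directions outside \<open>?K\<close> have model value above \<open>F x\<close>;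
    the minimizer over \<open>?K\<close> does not.\<close>
  then have "model e x s \<le> model e x t" if "t \<in> ?D" for t
    using that by (cases "model e x t \<le> F x") auto
  then show ?thesis using s by blast
qed

text \<open>\<open>arg_min_on\<close> is a choice operator and yields a minimizer only because one
  exists. The second claim chains majorization at the chosen direction with its minimality against
  \<open>s\<close>.\<close>

lemma
  shows step_direction: "step e x - x \<in> pair_directions b a e"
    and F_step_le_model: "s \<in> pair_directions b a e \<Longrightarrow> F (step e x) \<le> model e x s"
proof -
  let ?D = "pair_directions b a e" and ?d = "arg_min_on (model e x) (pair_directions b a e)"
  obtain u where "u \<in> ?D" "\<forall>t\<in>?D. model e x u \<le> model e x t"
    using model_minimizer_exists by blast
  then have "is_arg_min (model e x) (\<lambda>s. s \<in> ?D) u" by (simp add: is_arg_min_linorder)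
  then have "is_arg_min (model e x) (\<lambda>s. s \<in> ?D) ?d"
    unfolding arg_min_on_def arg_min_def by (rule someI)
  then have d: "?d \<in> ?D" "\<And>s. s \<in> ?D \<Longrightarrow> model e x ?d \<le> model e x s"
    by (simp_all add: is_arg_min_linorder)
  show "step e x - x \<in> ?D" using d by (simp add: rcd_step_def)
  show "F (step e x) \<le> model e x s" if "s \<in> ?D"
    using F_le_model[OF d(1), of x] d(2)[OF that] by (simp add: rcd_step_def)
qed

lemma step_feasible:
  assumes "a \<bullet> x = 0" shows "a \<bullet> step e x = 0"
proof -
  have "a \<bullet> (step e x - x) = 0"
    using step_direction[of e x] sum_inner_blk[of b e "step e x - x" a]
    by (auto simp: pair_directions_def)
  then show ?thesis using assms by (simp add: inner_diff_right)
qed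

lemma iterate_feasible:
  assumes "a \<bullet> x0 = 0" shows "a \<bullet> rcd_iterate b L \<alpha> f g h a x0 p k = 0"
  using assms by (induction k) (auto intro: step_feasible)

section \<open>Decrease summed over all pairs\<close>

lemma sum_model_le:
  assumes "a \<bullet> s = 0"
  shows "\<exists>t. (\<forall>e. card e = 2 \<longrightarrow> t e \<in> pair_directions b a e) \<and>
    (\<Sum>e | card e = 2. model e x (t e) - F x) \<le> F (x + s) - F x + Lmax_pow * (wnorm b L \<alpha> s)\<^sup>2"
proof -
  let ?E = "{e :: 'b set. card e = 2}"
  let ?n = "\<lambda>i. L i powr \<alpha> * (norm (blk b i s))\<^sup>2"
  have "(\<Sum>i\<in>UNIV. blk b i a \<bullet> blk b i s) = 0"
    using assms sum_inner_blk[of b UNIV s a] by simp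
  then obtain \<theta> :: "'b set \<Rightarrow> 'b \<Rightarrow> real" where \<theta>_nonneg: "\<And>e i. \<theta> e i \<ge> 0"
    and \<theta>_sum: "\<And>i. (\<Sum>e | card e = 2 \<and> i \<in> e. \<theta> e i) = 1"
    and \<theta>_dir: "\<And>e. card e = 2 \<Longrightarrow> (\<Sum>i\<in>e. \<theta> e i * (blk b i a \<bullet> blk b i s)) = 0"
    by (rule pair_weights_exist[OF two_blocks]) blast
  have \<theta>_le_1: "\<theta> e i \<le> 1" if "card e = 2" "i \<in> e" for e i
    using member_le_sum[of e "{e. card e = 2 \<and> i \<in> e}" "\<lambda>e. \<theta> e i"] that \<theta>_nonneg \<theta>_sum by auto
  \<comment> \<open>The weights of a block total 1, so summing over pairs returns every block
    quantity once.\<close>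
  have total: "(\<Sum>e | card e = 2. \<Sum>i\<in>e. \<theta> e i * D i) = sum D UNIV" for D
    by (simp add: sum_pairs_swap \<theta>_sum)
  define t where "t e = (\<chi> c. if b c \<in> e then \<theta> e (b c) * s $ c else 0)" for e
  have t_supp: "t e $ c = 0" if "b c \<notin> e" for e c using that by (simp add: t_def)
  have blk_t: "blk b i (t e) = \<theta> e i *\<^sub>R blk b i s" if "i \<in> e" for i e
    using that by (auto simp: t_def vec_eq_iff)
  have dir: "t e \<in> pair_directions b a e" if "card e = 2" for e
    using \<theta>_dir[OF that] by (simp add: pair_directions_def t_supp blk_t)
  \<comment> \<open>The linear part scales exactly, \<open>h\<close> is handled by separability and
    convexity in each block, and the quadratic part by
    \<open>(\<theta> e i)\<^sup>2 \<le> \<theta> e i\<close> for weights in the unit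
    interval.\<close>
  have "model e x (t e) - F x \<le> (\<Sum>i\<in>e. \<theta> e i * (blk b i (g x) \<bullet> blk b i s))
      + Lmax_pow * (\<Sum>i\<in>e. \<theta> e i * ?n i) + (\<Sum>i\<in>e. \<theta> e i * (h (x + blk b i s) - h x))"
    if e: "card e = 2" for e
  proof -
    have h_block: "h (x + \<theta> e i *\<^sub>R blk b i s) - h x \<le> \<theta> e i * (h (x + blk b i s) - h x)"
      if "i \<in> e" for i
    proof -
      have "x + \<theta> e i *\<^sub>R blk b i s = (1 - \<theta> e i) *\<^sub>R x + \<theta> e i *\<^sub>R (x + blk b i s)"
        by (simp add: algebra_simps)
      then have "h (x + \<theta> e i *\<^sub>R blk b i s) \<le> (1 - \<theta> e i) * h x + \<theta> e i * h (x + blk b i s)"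
        using convex_onD[OF h_convex, of "\<theta> e i" x "x + blk b i s"] \<theta>_nonneg \<theta>_le_1[OF e that] by simp
      then show ?thesis by (simp add: algebra_simps)
    qed
    have "h (x + t e) - h x \<le> (\<Sum>i\<in>e. \<theta> e i * (h (x + blk b i s) - h x))"
      by (subst separable_block_sum[OF h_separable t_supp], assumption, rule sum_mono)
        (simp add: blk_t h_block)
    moreover have "(\<Sum>i\<in>e. L i powr (1 - \<alpha>)) / 2 * (\<Sum>i\<in>e. L i powr \<alpha> * (norm (blk b i (t e)))\<^sup>2)
        \<le> Lmax_pow * (\<Sum>i\<in>e. \<theta> e i * ?n i)"
    proof (rule mult_mono)
      \<comment> \<open>A pair has two elements, so this is an average of two powers.\<close>
      show "(\<Sum>i\<in>e. L i powr (1 - \<alpha>)) / 2 \<le> Lmax_pow"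
        using sum_bounded_above[of e "\<lambda>i. L i powr (1 - \<alpha>)" Lmax_pow] e pow_le_Lmax_pow by simp
      have "L i powr \<alpha> * (norm (blk b i (t e)))\<^sup>2 \<le> \<theta> e i * ?n i" if "i \<in> e" for i
      proof -
        have "(\<theta> e i)\<^sup>2 \<le> \<theta> e i"
          using \<theta>_nonneg \<theta>_le_1[OF e that] by (simp add: power2_eq_square mult_left_le)
        then have "(\<theta> e i)\<^sup>2 * ?n i \<le> \<theta> e i * ?n i" by (rule mult_right_mono) simp
        then show ?thesis using that by (simp add: blk_t power_mult_distrib mult_ac)
      qed
      then show "(\<Sum>i\<in>e. L i powr \<alpha> * (norm (blk b i (t e)))\<^sup>2) \<le> (\<Sum>i\<in>e. \<theta> e i * ?n i)"
        by (rule sum_mono)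
    qed (auto intro!: sum_nonneg less_imp_le[OF Lmax_pow_pos])
    moreover have "(\<Sum>i\<in>e. blk b i (g x) \<bullet> blk b i (t e)) = (\<Sum>i\<in>e. \<theta> e i * (blk b i (g x) \<bullet> blk b i s))"
      by (simp add: blk_t)
    ultimately show ?thesis by (simp add: pair_model_def F_eq)
  qed
  then have "(\<Sum>e\<in>?E. model e x (t e) - F x) \<le> (\<Sum>e\<in>?E. (\<Sum>i\<in>e. \<theta> e i * (blk b i (g x) \<bullet> blk b i s))
      + Lmax_pow * (\<Sum>i\<in>e. \<theta> e i * ?n i) + (\<Sum>i\<in>e. \<theta> e i * (h (x + blk b i s) - h x)))"
    by (intro sum_mono) simp
  also have "\<dots> = (\<Sum>i\<in>UNIV. blk b i (g x) \<bullet> blk b i s) + Lmax_pow * sum ?n UNIV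
      + (\<Sum>i\<in>UNIV. h (x + blk b i s) - h x)"
    by (simp only: sum.distrib sum_distrib_left[symmetric] total)
  also have "\<dots> = g x \<bullet> s + Lmax_pow * (wnorm b L \<alpha> s)\<^sup>2 + (h (x + s) - h x)"
    using sum_inner_blk[of b UNIV s "g x"] separable_block_sum[of h b UNIV s x, OF h_separable]
    by (simp add: wnorm_power2[OF L_pos])
  also have "\<dots> \<le> F (x + s) - F x + Lmax_pow * (wnorm b L \<alpha> s)\<^sup>2"
    using convex_above_gradient[OF f_convex f_gradient, of x s] by (simp add: F_eq)
  finally show ?thesis using dir by blast
qed

definition rate :: real where
  "rate = \<sigma> / (2 * Lmax_pow + \<sigma>)"

lemma rate_bounds: "0 < rate" "rate \<le> 1"
  using Lmax_pow_pos \<sigma>_pos by (auto simp: rate_def)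

text \<open>\<^const>\<open>rate\<close> is the step length towards \<open>y\<close> for which the quadratic term of the model and the
  strong convexity gain cancel, so that no minimizer of \<open>F\<close> is needed.\<close>

lemma sum_step_le:
  assumes "a \<bullet> x = 0" "a \<bullet> y = 0"
  shows "(\<Sum>e | card e = 2. F (step e x) - F x) \<le> rate * (F y - F x)"
proof -
  let ?W = "(wnorm b L \<alpha> (y - x))\<^sup>2"
  have "a \<bullet> (rate *\<^sub>R (y - x)) = 0" using assms by (simp add: inner_diff_right)
  from sum_model_le[OF this, of x] obtain t where
    t: "\<And>e. card e = 2 \<Longrightarrow> t e \<in> pair_directions b a e"
    and le: "(\<Sum>e | card e = 2. model e x (t e) - F x)
      \<le> F (x + rate *\<^sub>R (y - x)) - F x + Lmax_pow * (wnorm b L \<alpha> (rate *\<^sub>R (y - x)))\<^sup>2" by blast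
  have "(\<Sum>e | card e = 2. F (step e x) - F x) \<le> (\<Sum>e | card e = 2. model e x (t e) - F x)"
    using t by (intro sum_mono) (auto intro: F_step_le_model)
  also note le
  also have "F (x + rate *\<^sub>R (y - x)) - F x + Lmax_pow * (wnorm b L \<alpha> (rate *\<^sub>R (y - x)))\<^sup>2
      \<le> rate * (F y - F x) + rate * (rate * Lmax_pow - \<sigma> / 2 * (1 - rate)) * ?W"
    using strongly_convex_wrt_segment[OF L_pos F_strongly_convex, of rate x "y - x"] rate_bounds
    unfolding wnorm_scaleR_power2[OF L_pos] by (simp add: algebra_simps power2_eq_square diff_divide_distrib)
  also have "rate * Lmax_pow - \<sigma> / 2 * (1 - rate) = 0"
    using Lmax_pow_pos \<sigma>_pos by (simp add: rate_def field_simps)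
  finally show ?thesis by simp
qed

section \<open>Optimal value and comparison of rates\<close>

lemma F_bounded_below: "bdd_below (range F)"
proof -
  obtain c and v :: "real ^ 'n" where c: "c > 0" and v: "\<And>s. F (0 + s) \<ge> F 0 - norm v * norm s + c * (norm s)\<^sup>2"
    by (rule strongly_convex_wrt_norm_bound[OF L_pos \<sigma>_pos F_strongly_convex]) blast
  \<comment> \<open>The constant is the minimum of the quadratic lower bound, found by completing
    the square in \<open>norm x\<close>.\<close>
  have "F x \<ge> F 0 - (norm v)\<^sup>2 / (4 * c)" for x
  proof -
    have "0 \<le> (2 * c * norm x - norm v)\<^sup>2 / (4 * c)" using c by simp
    also have "\<dots> = c * (norm x)\<^sup>2 - norm v * norm x + (norm v)\<^sup>2 / (4 * c)"
      using c by (simp add: field_simps power2_eq_square)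
    finally show ?thesis using v[of x] by simp
  qed
  then show ?thesis by (auto simp: bdd_below_def)
qed

lemma optval_le: "a \<bullet> x = 0 \<Longrightarrow> optval a F \<le> F x"
  unfolding optval_def
  by (intro cINF_lower bdd_below_mono[OF F_bounded_below]) auto

text \<open>Solved for \<open>F y\<close>, the bound of \<open>sum_step_le\<close> has a left side
  independent of \<open>y\<close> and so passes to the infimum.\<close>

lemma sum_step_optval:
  assumes "a \<bullet> x = 0"
  shows "(\<Sum>e | card e = 2. F (step e x) - F x) \<le> - rate * (F x - optval a F)"
proof -
  let ?S = "\<Sum>e | card e = 2. F (step e x) - F x"
  have "?S / rate + F x \<le> optval a F"
    unfolding optval_def
  proof (rule cINF_greatest)
    show "{x. a \<bullet> x = 0} \<noteq> {}" using assms by blast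
    fix y assume "y \<in> {x. a \<bullet> x = 0}"
    then show "?S / rate + F x \<le> F y"
      using sum_step_le[OF assms, of y] rate_bounds by (simp add: field_simps)
  qed
  then show ?thesis using rate_bounds by (simp add: field_simps)
qed

lemma one_minus_gamma_le_rate: "1 - rcd_gamma (Max (range L)) \<alpha> \<sigma> \<le> rate"
proof (cases "\<sigma> \<le> 4 * Lmax_pow")
  case True
  \<comment> \<open>In this case \<open>2 * Lmax_pow + \<sigma> \<le> 6 * Lmax_pow\<close>.\<close>
  then have "\<sigma> / (8 * Lmax_pow) \<le> \<sigma> / (2 * Lmax_pow + \<sigma>)"
    using Lmax_pow_pos \<sigma>_pos by (intro divide_left_mono) auto
  then show ?thesis using True by (simp add: rcd_gamma_def rate_def Lmax_pow_def)
next
  case False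
  have "1 - 2 * Lmax_pow / \<sigma> = (\<sigma> - 2 * Lmax_pow) / \<sigma>" using \<sigma>_pos by (simp add: field_simps)
  \<comment> \<open>Cross multiplication leaves \<open>\<sigma>\<^sup>2 - 4 * Lmax_pow\<^sup>2 \<le>
    \<sigma>\<^sup>2\<close>.\<close>
  also have "\<dots> \<le> \<sigma> / (2 * Lmax_pow + \<sigma>)"
    using \<sigma>_pos Lmax_pow_pos by (simp add: divide_simps power2_eq_square algebra_simps)
  finally show ?thesis using False by (simp add: rcd_gamma_def rate_def Lmax_pow_def)
qed

end

section \<open>Expectations over finite histories of independent choices\<close>

context prob_space
begin

text \<open>A finite product of finite discrete spaces is discrete.\<close>

lemma measurable_PiM_finite_count_space:
  fixes \<phi> :: "(nat \<Rightarrow> 'c::finite) \<Rightarrow> real"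
  assumes "finite I"
  shows "\<phi> \<in> borel_measurable (PiM I (\<lambda>_. count_space UNIV))"
  using count_space_PiM_finite[OF assms, of "\<lambda>_. UNIV :: 'c set"] by simp

lemma integrable_finite_history:
  fixes P :: "nat \<Rightarrow> 'a \<Rightarrow> 'c::finite" and \<phi> :: "(nat \<Rightarrow> 'c) \<Rightarrow> real"
  assumes P: "\<And>m. P m \<in> measurable M (count_space UNIV)"
    and \<phi>: "\<And>p q. (\<And>m. m < k \<Longrightarrow> p m = q m) \<Longrightarrow> \<phi> p = \<phi> q"
  shows "integrable M (\<lambda>\<omega>. \<phi> (\<lambda>m. P m \<omega>))"
proof -
  let ?X = "\<lambda>\<omega>. \<lambda>m\<in>{..<k}. P m \<omega>" and ?S = "{..<k} \<rightarrow>\<^sub>E (UNIV :: 'c set)"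
  have eq: "\<phi> (\<lambda>m. P m \<omega>) = \<phi> (?X \<omega>)" for \<omega> by (rule \<phi>) simp
  have "?X \<in> measurable M (PiM {..<k} (\<lambda>_. count_space UNIV))"
    using P by (intro measurable_restrict)
  then have meas: "(\<lambda>\<omega>. \<phi> (?X \<omega>)) \<in> borel_measurable M"
    by (rule measurable_compose) (simp add: measurable_PiM_finite_count_space)
  have "finite ?S" by (intro finite_PiE) auto
  \<comment> \<open>Only finitely many restricted histories exist; summing over all of them gives a
    crude uniform bound.\<close>
  then have "norm (\<phi> (?X \<omega>)) \<le> (\<Sum>p\<in>?S. norm (\<phi> p))" for \<omega>
    by (intro member_le_sum[of "?X \<omega>" ?S "\<lambda>p. norm (\<phi> p)"]) auto
  then show ?thesis unfolding eq by (intro integrable_const_bound[OF _ meas]) auto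
qed

text \<open>The expectation is split by the value of \<open>P k\<close>. Once that value is fixed,
  the integrand reads only earlier choices and is independent of the indicator of the event.\<close>

lemma expectation_indep_next:
  fixes P :: "nat \<Rightarrow> 'a \<Rightarrow> 'c::finite" and \<psi> :: "(nat \<Rightarrow> 'c) \<Rightarrow> 'c \<Rightarrow> real"
  assumes indep: "indep_vars (\<lambda>_. count_space UNIV) P UNIV"
    and \<psi>: "\<And>p q c. (\<And>m. m < k \<Longrightarrow> p m = q m) \<Longrightarrow> \<psi> p c = \<psi> q c"
  shows "expectation (\<lambda>\<omega>. \<psi> (\<lambda>m. P m \<omega>) (P k \<omega>))
    = (\<Sum>c\<in>UNIV. expectation (\<lambda>\<omega>. \<psi> (\<lambda>m. P m \<omega>) c) * prob {\<omega> \<in> space M. P k \<omega> = c})"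
proof -
  have P: "P m \<in> measurable M (count_space UNIV)" for m
    using indep by (simp add: indep_vars_def)
  let ?ind = "\<lambda>c \<omega>. indicator {\<omega> \<in> space M. P k \<omega> = c} \<omega> :: real"
  have sets: "{\<omega> \<in> space M. P k \<omega> = c} \<in> events" for c
    using measurable_sets[OF P, of "{c}" k] by (simp add: vimage_def Int_def conj_commute)
  have int: "integrable M (\<lambda>\<omega>. \<psi> (\<lambda>m. P m \<omega>) c)" for c
    using P \<psi> by (rule integrable_finite_history)
  have prod: "integrable M (\<lambda>\<omega>. \<psi> (\<lambda>m. P m \<omega>) c * ?ind c \<omega>) \<and>
      expectation (\<lambda>\<omega>. \<psi> (\<lambda>m. P m \<omega>) c * ?ind c \<omega>)
      = expectation (\<lambda>\<omega>. \<psi> (\<lambda>m. P m \<omega>) c) * prob {\<omega> \<in> space M. P k \<omega> = c}" for c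
  proof -
    have "indep_var borel ((\<lambda>p. \<psi> p c) \<circ> (\<lambda>\<omega>. \<lambda>m\<in>{..<k}. P m \<omega>))
        borel ((\<lambda>p. indicator {c} (p k)) \<circ> (\<lambda>\<omega>. \<lambda>m\<in>{k}. P m \<omega>) :: 'a \<Rightarrow> real)"
      by (rule indep_var_compose[OF indep_var_restrict[OF indep]])
        (simp_all add: measurable_PiM_finite_count_space)
    moreover have "\<psi> (\<lambda>m\<in>{..<k}. P m \<omega>) c = \<psi> (\<lambda>m. P m \<omega>) c" for \<omega>
      by (rule \<psi>) simp
    ultimately have ind: "indep_var borel (\<lambda>\<omega>. \<psi> (\<lambda>m. P m \<omega>) c)
        borel (\<lambda>\<omega>. indicator {c} (P k \<omega>) :: real)"
      by (simp add: comp_def)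
    \<comment> \<open>Reading the choice with index \<open>k\<close> takes a history of length
      \<open>Suc k\<close>.\<close>
    have int2: "integrable M (\<lambda>\<omega>. indicator {c} (P k \<omega>) :: real)"
      by (rule integrable_finite_history[where k = "Suc k" and \<phi> = "\<lambda>p. indicator {c} (p k)", OF P]) simp
    have eq: "indicator {c} (P k \<omega>) = ?ind c \<omega>" if "\<omega> \<in> space M" for \<omega>
      using that by (simp add: indicator_def)
    have "expectation (\<lambda>\<omega>. indicator {c} (P k \<omega>)) = expectation (?ind c)"
      by (intro Bochner_Integration.integral_cong) (simp_all add: eq)
    also have "\<dots> = prob {\<omega> \<in> space M. P k \<omega> = c}"
      using sets by simp
    finally show ?thesis
      using indep_var_lebesgue_integral[OF ind int int2] indep_var_integrable[OF ind int int2]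
      by (simp add: eq cong: Bochner_Integration.integral_cong Bochner_Integration.integrable_cong)
  qed
  have "expectation (\<lambda>\<omega>. \<psi> (\<lambda>m. P m \<omega>) (P k \<omega>))
      = expectation (\<lambda>\<omega>. \<Sum>c\<in>UNIV. \<psi> (\<lambda>m. P m \<omega>) c * ?ind c \<omega>)"
    by (intro Bochner_Integration.integral_cong) (simp_all add: indicator_def if_distrib sum.delta' cong: if_cong)
  also have "\<dots> = (\<Sum>c\<in>UNIV. expectation (\<lambda>\<omega>. \<psi> (\<lambda>m. P m \<omega>) c) * prob {\<omega> \<in> space M. P k \<omega> = c})"
    using prod by (subst Bochner_Integration.integral_sum) simp_all
  finally show ?thesis .
qed

end

text \<open>The number of pairs times their common probability is already 1, leaving nothing for a
  further disjoint event. This reduces sums over all sets of blocks to sums over pairs.\<close>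

lemma prob_not_pair:
  fixes e :: "'b::finite set"
  assumes "prob_space M" and P: "P \<in> measurable M (count_space UNIV)" and "CARD('b) \<ge> 2"
    and uniform: "\<And>i j :: 'b. i \<noteq> j \<Longrightarrow>
      measure M {\<omega> \<in> space M. P \<omega> = {i, j}} = 2 / (real CARD('b) * (real CARD('b) - 1))"
    and e: "card e \<noteq> 2"
  shows "measure M {\<omega> \<in> space M. P \<omega> = e} = 0"
proof -
  interpret prob_space M by fact
  let ?E = "{e :: 'b set. card e = 2}" and ?A = "\<lambda>e. {\<omega> \<in> space M. P \<omega> = e}"
  have sets: "?A e \<in> events" for e
    using measurable_sets[OF P, of "{e}"] by (simp add: vimage_def Int_def conj_commute)
  have "prob (\<Union>e\<in>insert e ?E. ?A e) = (\<Sum>e\<in>insert e ?E. prob (?A e))"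
    using sets by (intro finite_measure_finite_Union) (auto simp: disjoint_family_on_def)
  also have "\<dots> = prob (?A e) + (\<Sum>e\<in>?E. prob (?A e))"
    using e by simp
  also have "(\<Sum>e\<in>?E. prob (?A e)) = (\<Sum>e\<in>?E. 2 / (real CARD('b) * (real CARD('b) - 1)))"
    by (intro sum.cong) (auto simp: card_2_iff uniform)
  also have "\<dots> = real (card ?E) * (2 / (real CARD('b) * (real CARD('b) - 1)))" by simp
  also have "card ?E = CARD('b) choose 2"
    using n_subsets[of "UNIV :: 'b set" 2] by simp
  also have "real (CARD('b) choose 2) = real CARD('b) * (real CARD('b) - 1) / 2"
    using choose_two[of "CARD('b)"] assms(3) by (simp add: real_of_nat_div of_nat_diff)
  also have "\<dots> * (2 / (real CARD('b) * (real CARD('b) - 1))) = 1"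
    using assms(3) by simp
  finally show ?thesis
    using prob_le_1[of "\<Union>e\<in>insert e ?E. ?A e"] measure_nonneg[of M "?A e"] by simp
qed

section \<open>Contraction of the expected gap\<close>

lemma rcd_iterate_cong:
  assumes "\<And>m. m < k \<Longrightarrow> p m = q m"
  shows "rcd_iterate b L \<alpha> f g h a x0 p k = rcd_iterate b L \<alpha> f g h a x0 q k"
  using assms by (induction k) auto

theorem theorem2:
  fixes f h F :: "real ^ 'n::finite \<Rightarrow> real"
    and g :: "real ^ 'n \<Rightarrow> real ^ 'n"
    and a x0 :: "real ^ 'n"
    and b :: "'n \<Rightarrow> 'b::finite"
    and L :: "'b \<Rightarrow> real"
    and \<alpha> \<sigma> :: real
    and M :: "'w measure"
    and P :: "nat \<Rightarrow> 'w \<Rightarrow> 'b set"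
    and k :: nat
  assumes blocks: "surj b" "CARD('b) \<ge> 2"
    and f_convex: "convex_on UNIV f"
    and f_gradient: "\<And>x. GDERIV f x :> g x"
    and L_pos: "\<And>i. L i > 0"
    and f_lipschitz: "block_lipschitz_gradient b L g"
    and h_closed_convex: "closed (epigraph UNIV h)" "convex_on UNIV h"
    and h_separable: "coordinatewise_separable h"
    and F_eq: "\<And>x. F x = f x + h x"
    and alpha: "0 \<le> \<alpha>" "\<alpha> \<le> 1"
    and x0_feasible: "a \<bullet> x0 = 0"
    and R_finite: "level_radius (wnorm b L \<alpha>) a F x0 < \<infinity>"
    and F_strongly_convex: "\<sigma> > 0" "strongly_convex_wrt (wnorm b L \<alpha>) \<sigma> F"
    and prob: "prob_space M"
    and pairs_indep: "prob_space.indep_vars M (\<lambda>_. count_space UNIV) P UNIV"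
    and pairs_uniform: "\<And>m i j. i \<noteq> j \<Longrightarrow>
          measure M {\<omega> \<in> space M. P m \<omega> = {i, j}} = 2 / (real CARD('b) * (real CARD('b) - 1))"
  shows "prob_space.expectation M (\<lambda>\<omega>. F (rcd_iterate b L \<alpha> f g h a x0 (\<lambda>m. P m \<omega>) k)) - optval a F
         \<le> (1 - 2 * (1 - rcd_gamma (Max (range L)) \<alpha> \<sigma>) / (real CARD('b))\<^sup>2) ^ k
            * (F x0 - optval a F)"
proof -
  interpret composite_problem f h F g a b L \<alpha> \<sigma>
    using blocks(2) f_convex f_gradient L_pos f_lipschitz h_closed_convex(2) h_separable F_eq
      alpha(2) F_strongly_convex by unfold_locales
  interpret prob_space M by (rule prob)
  have P: "P m \<in> measurable M (count_space UNIV)" for m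
    using pairs_indep by (simp add: indep_vars_def)
  let ?N = "real CARD('b)"
  let ?p = "2 / (?N * (?N - 1))" and ?c = "2 * (1 - rcd_gamma (Max (range L)) \<alpha> \<sigma>) / ?N\<^sup>2"
  let ?it = "\<lambda>p k. rcd_iterate b L \<alpha> f g h a x0 p k"
  let ?E = "\<lambda>k. expectation (\<lambda>\<omega>. F (?it (\<lambda>m. P m \<omega>) k))"
  have N: "?N \<ge> 2" using blocks(2) by simp
  have feasible: "a \<bullet> ?it p k = 0" for p k using x0_feasible by (rule iterate_feasible)
  have int: "integrable M (\<lambda>\<omega>. \<phi> (?it (\<lambda>m. P m \<omega>) k))" for \<phi> :: "real ^ 'n \<Rightarrow> real" and k
    using P by (rule integrable_finite_history) (rule arg_cong[OF rcd_iterate_cong])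
  \<comment> \<open>The sign of the gap allows \<open>?p * rate\<close> to be replaced by the
    smaller \<open>?c\<close> below.\<close>
  have gap: "?E k - optval a F \<ge> 0" for k
    using integral_mono[OF integrable_const int, of "optval a F" F k] optval_le[OF feasible]
    by (simp add: prob_space)
  have c_rate: "?c \<le> 2 * rate / ?N\<^sup>2"
    using one_minus_gamma_le_rate by (intro divide_right_mono) auto
  also have "\<dots> \<le> ?p * rate"
    using N rate_bounds by (simp add: frac_le power2_eq_square)
  finally have c_le: "?c \<le> ?p * rate" .
  \<comment> \<open>With at least two blocks \<open>?c\<close> is at most 1/2; the induction needs
    \<open>1 - ?c\<close> nonnegative.\<close>
  have "2 * rate / ?N\<^sup>2 \<le> 2 * 1 / 2\<^sup>2"
    using N rate_bounds by (intro frac_le mult_left_mono power_mono) auto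
  also have "\<dots> \<le> (1 :: real)" by simp
  finally have c_le_1: "?c \<le> 1" using c_rate by (rule order_trans[rotated])
  have contraction: "?E (Suc k) - optval a F \<le> (1 - ?c) * (?E k - optval a F)" for k
  proof -
    \<comment> \<open>The change of \<open>F\<close> if \<open>e\<close> is the next pair,
      separating the history from the fresh choice.\<close>
    let ?D = "\<lambda>p e. F (step e (?it p k)) - F (?it p k)"
    have D_int: "integrable M (\<lambda>\<omega>. ?D (\<lambda>m. P m \<omega>) e)" for e
      by (rule int)
    have "?E (Suc k) - ?E k = expectation (\<lambda>\<omega>. ?D (\<lambda>m. P m \<omega>) (P k \<omega>))"
      using int[of F "Suc k"] int[of F k] by simp
    also have "\<dots> = (\<Sum>e\<in>UNIV. expectation (\<lambda>\<omega>. ?D (\<lambda>m. P m \<omega>) e) * prob {\<omega> \<in> space M. P k \<omega> = e})"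
    proof (rule expectation_indep_next[OF pairs_indep])
      fix p q :: "nat \<Rightarrow> 'b set" and e
      assume "\<And>m. m < k \<Longrightarrow> p m = q m"
      then have "?it p k = ?it q k" by (rule rcd_iterate_cong)
      then show "?D p e = ?D q e" by simp
    qed
    also have "\<dots> = (\<Sum>e | card e = 2. expectation (\<lambda>\<omega>. ?D (\<lambda>m. P m \<omega>) e) * prob {\<omega> \<in> space M. P k \<omega> = e})"
      using prob_not_pair[OF prob P blocks(2) pairs_uniform] by (intro sum.mono_neutral_right) auto
    also have "\<dots> = (\<Sum>e | card e = 2. expectation (\<lambda>\<omega>. ?D (\<lambda>m. P m \<omega>) e) * ?p)"
      by (intro sum.cong) (auto simp: card_2_iff pairs_uniform)
    also have "\<dots> = ?p * expectation (\<lambda>\<omega>. \<Sum>e | card e = 2. ?D (\<lambda>m. P m \<omega>) e)"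
      using D_int by (subst Bochner_Integration.integral_sum) (simp_all add: sum_distrib_left mult.commute)
    \<comment> \<open>The decrease summed over pairs holds for each history, hence in
      expectation.\<close>
    also have "\<dots> \<le> ?p * expectation (\<lambda>\<omega>. - rate * (F (?it (\<lambda>m. P m \<omega>) k) - optval a F))"
    proof (intro mult_left_mono integral_mono)
      show "integrable M (\<lambda>\<omega>. \<Sum>e | card e = 2. ?D (\<lambda>m. P m \<omega>) e)"
        by (intro Bochner_Integration.integrable_sum D_int)
      show "integrable M (\<lambda>\<omega>. - rate * (F (?it (\<lambda>m. P m \<omega>) k) - optval a F))"
        by (rule int)
      show "(\<Sum>e | card e = 2. ?D (\<lambda>m. P m \<omega>) e) \<le> - rate * (F (?it (\<lambda>m. P m \<omega>) k) - optval a F)" for \<omega>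
        by (intro sum_step_optval feasible)
      show "0 \<le> ?p" using N by simp
    qed
    also have "\<dots> = - (?p * rate * (?E k - optval a F))"
      using int[of F k] by (simp add: prob_space)
    also have "\<dots> \<le> - (?c * (?E k - optval a F))"
      using mult_right_mono[OF c_le gap[of k]] by simp
    finally show ?thesis by (simp add: algebra_simps)
  qed
  show ?thesis
  proof (induction k)
    case 0
    show ?case by (simp add: prob_space)
  next
    case (Suc k)
    have "?E (Suc k) - optval a F \<le> (1 - ?c) * (?E k - optval a F)" by (rule contraction)
    also have "\<dots> \<le> (1 - ?c) * ((1 - ?c) ^ k * (F x0 - optval a F))"
      using Suc c_le_1 by (intro mult_left_mono) auto
    finally show ?case by simp
  qed
qed

end
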